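(* $f_6(5)=\dfrac{5}{6}$.
   Context: $\Delta(\cdot)$ denotes area in the Euclidean plane. For integers $n,m$ with $3\le m\le n-1$, define $$f_n(m)=\min_{P\in\mathcal{P}_n}\ \max_{Q\subset P,\ |Q|=m}\frac{\Delta(Q)}{\Delta(P)},$$ where $\mathcal{P}_n$ is the class of all convex $n$-gons in the plane and, for each $P$, the maximum is taken over all convex $m$-gons $Q$ contained in $P$ ($|Q|$ denotes the number of vertices of $Q$). *)

theory Defs
  imports "HOL-Analysis.Analysis"
begin

text \<open>
  A convex polygon is a closed region of the plane, and its vertices are its extreme points (so
  there is no angle of size \<open>\<pi>\<close> at a vertex). For \<open>n \<ge> 3\<close> such a region is automatically
  nondegenerate, since a convex set contained in a line has at most two extreme points.
\<close>

definition convex_ngon :: "nat \<Rightarrow> (real^2) set \<Rightarrow> bool" where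
  "convex_ngon n P \<longleftrightarrow> polytope P \<and> card {v. v extreme_point_of P} = n"

abbreviation area :: "(real^2) set \<Rightarrow> real" where
  "area P \<equiv> measure lborel P"

text \<open>
  The operators \<open>GREATEST\<close> and \<open>LEAST\<close> denote an attained maximum and minimum, not a supremum and
  infimum: their value is unspecified if there is no greatest or least element. The quantity
  \<open>minmax_ratio n m\<close>, that is $f_n(m)$, is meaningful for \<open>3 \<le> m \<le> n - 1\<close>.
\<close>

definition max_ratio :: "nat \<Rightarrow> (real^2) set \<Rightarrow> real" where
  "max_ratio m P = (GREATEST r. \<exists>Q. convex_ngon m Q \<and> Q \<subseteq> P \<and> r = area Q / area P)"

definition minmax_ratio :: "nat \<Rightarrow> nat \<Rightarrow> real" where
  "minmax_ratio n m = (LEAST r. \<exists>P. convex_ngon n P \<and> r = max_ratio m P)"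

end

theory Submission
  imports Defs
begin

text \<open>
  A largest pentagon inside a hexagon can be found among the hulls of five of its vertices. Indeed,
  if a vertex \<open>p\<close> of a polygon has neighbours \<open>a\<close> and \<open>b\<close>, the area is that of the hull of the other
  vertices plus that of the triangle \<open>a p b\<close>, and the latter is an affine function of \<open>p\<close>; so \<open>p\<close> can be
  moved to a vertex of the surrounding polygon without loss of area. Repeating this
  (\<open>area_le_vertex_hull\<close>) leaves only vertices of the surrounding polygon, which turns the maximum over
  all inscribed polygons into one over a finite family (\<open>max_ratio_vertices\<close>); in particular it is
  attained.

  For a hexagon \<open>P = abcdef\<close>, the hull of five vertices is \<open>P\<close> minus an ear, a triangle formed by three
  consecutive vertices. Hence the maximal ratio is \<open>1 - \<epsilon>\<close>, where \<open>\<epsilon>\<close> is the area of the smallest ear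
  divided by that of \<open>P\<close>, and the claim is that \<open>\<epsilon> \<le> 1/6\<close>, with equality for some hexagon. Equality
  holds for an affine image of the regular hexagon. For the inequality (\<open>hexagon_least_ear\<close>), let the
  main diagonals meet in \<open>p = ad \<inter> cf\<close>, \<open>q = ad \<inter> be\<close> and \<open>r = be \<inter> cf\<close>. The triangles
  \<open>pab\<close>, \<open>pbc\<close>, \<open>rcd\<close>, \<open>rde\<close>, \<open>qef\<close>, \<open>qfa\<close> and \<open>prq\<close> tile \<open>P\<close>. In each of the first six, the apex
  lies on the main diagonal joining the two vertices of \<open>P\<close> adjacent to the side opposite to the apex;
  so its area is a weighted mean of the areas of two ears, and at least that of the smallest ear.
\<close>

section \<open>Signed area of a triangle\<close>

text \<open>Twice the signed area of the triangle; it is positive if \<open>a\<close>, \<open>b\<close>, \<open>c\<close> run counterclockwise.\<close>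

definition orient :: "real^2 \<Rightarrow> real^2 \<Rightarrow> real^2 \<Rightarrow> real" where
  "orient a b c = (b$1 - a$1) * (c$2 - a$2) - (b$2 - a$2) * (c$1 - a$1)"

lemma orient_cyclic: "orient b c a = orient a b c"
  by (simp add: orient_def algebra_simps)

lemma orient_degenerate [simp]: "orient a a b = 0" "orient a b b = 0" "orient b a b = 0"
  by (simp_all add: orient_def)

lemma orient_convex_combination:
  "orient ((1 - u) *\<^sub>R x + u *\<^sub>R y) a b = (1 - u) * orient x a b + u * orient y a b"
  by (simp add: orient_def algebra_simps)

lemma orient_as_inner:
  obtains w c where "\<And>x. orient x a b = w \<bullet> x + c" "a \<noteq> b \<Longrightarrow> w \<noteq> 0"
proof
  define w :: "real^2" where "w = vector [a$2 - b$2, b$1 - a$1]"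
  show "orient x a b = w \<bullet> x + (a$1 * b$2 - a$2 * b$1)" for x
    by (simp add: orient_def w_def inner_vec_def sum_2 algebra_simps)
  show "w \<noteq> 0" if "a \<noteq> b"
    using that by (auto simp: w_def vec_eq_iff forall_2)
qed

lemma convex_orient_halfplanes:
  "convex {x. orient x a b \<ge> c}" "convex {x. orient x a b \<le> c}" "convex {x. orient x a b < c}"
proof -
  obtain w d where w: "\<And>x. orient x a b = w \<bullet> x + d" using orient_as_inner by metis
  have "{x. orient x a b \<ge> c} = {x. w \<bullet> x \<ge> c - d}" "{x. orient x a b \<le> c} = {x. w \<bullet> x \<le> c - d}"
    "{x. orient x a b < c} = {x. w \<bullet> x < c - d}"
    by (auto simp: w)
  then show "convex {x. orient x a b \<ge> c}" "convex {x. orient x a b \<le> c}" "convex {x. orient x a b < c}"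
    by (simp_all add: convex_halfspace_ge convex_halfspace_le convex_halfspace_lt)
qed

lemma orient_hull_ge:
  assumes "x \<in> convex hull X" "\<And>s. s \<in> X \<Longrightarrow> orient s a b \<ge> c"
  shows "orient x a b \<ge> c"
proof -
  have "convex hull X \<subseteq> {x. orient x a b \<ge> c}"
    by (rule hull_minimal) (use assms convex_orient_halfplanes in auto)
  then show ?thesis using assms by auto
qed

lemma orient_hull_le:
  assumes "x \<in> convex hull X" "\<And>s. s \<in> X \<Longrightarrow> orient s a b \<le> c"
  shows "orient x a b \<le> c"
proof -
  have "convex hull X \<subseteq> {x. orient x a b \<le> c}"
    by (rule hull_minimal) (use assms convex_orient_halfplanes in auto)
  then show ?thesis using assms by auto
qed

lemma orient_hull_maximal:
  assumes "x \<in> convex hull X"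
  obtains v where "v \<in> X" "orient v a b \<ge> orient x a b"
proof -
  have "\<not> convex hull X \<subseteq> {y. orient y a b < orient x a b}"
    using assms by auto
  then have "\<not> X \<subseteq> {y. orient y a b < orient x a b}"
    using hull_minimal[of X _ convex] convex_orient_halfplanes(3) by metis
  then show thesis using that by force
qed

lemma barycentric_coordinates:
  assumes "orient p a b \<noteq> 0"
  shows "x = p + (orient p x b / orient p a b) *\<^sub>R (a - p) + (orient p a x / orient p a b) *\<^sub>R (b - p)"
    (is "x = ?r")
proof -
  let ?D = "orient p a b"
  have "?D *\<^sub>R x = ?D *\<^sub>R p + orient p x b *\<^sub>R (a - p) + orient p a x *\<^sub>R (b - p)"
    by (simp add: vec_eq_iff forall_2 orient_def algebra_simps)
  also have "\<dots> = ?D *\<^sub>R ?r" using assms by (simp add: scaleR_add_right)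
  finally show ?thesis using assms by (simp only: scaleR_cancel_left) simp
qed

text \<open>
The three signs say that the barycentric coordinates of \<open>x\<close> are nonnegative.
\<close>

lemma in_triangle:
  assumes "orient p a b > 0" "orient p x b \<ge> 0" "orient p a x \<ge> 0" "orient a x b \<le> 0"
  shows "x \<in> convex hull {p, a, b}"
proof -
  define u where "u = orient p x b / orient p a b"
  define v where "v = orient p a x / orient p a b"
  have uv: "u \<ge> 0" "v \<ge> 0" using assms by (auto simp: u_def v_def)
  have "orient p x b + orient p a x = orient p a b + orient a x b"
    by (simp add: orient_def algebra_simps)
  then have "u + v \<le> 1" using assms by (simp add: u_def v_def add_divide_distrib[symmetric])
  have "x = p + u *\<^sub>R (a - p) + v *\<^sub>R (b - p)"
    unfolding u_def v_def using assms by (intro barycentric_coordinates) auto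
  then have "x = (1 - u - v) *\<^sub>R p + u *\<^sub>R a + v *\<^sub>R b" by (simp add: algebra_simps)
  then show ?thesis using uv \<open>u + v \<le> 1\<close>
    unfolding convex_hull_3
    by (intro CollectI exI[of _ "1 - u - v"] exI[of _ u] exI[of _ v]) auto
qed

section \<open>Areas of hulls and cutting off an ear\<close>

lemma area_triangle: "area (convex hull {p, a, b}) = \<bar>orient p a b\<bar> / 2"
  by (subst content_triangle) (simp add: orient_def abs_minus_commute algebra_simps)

lemma lmeasurable_hull: "finite X \<Longrightarrow> convex hull X \<in> lmeasurable"
  by (simp add: finite_imp_compact_convex_hull lmeasurable_compact)

lemma area_eq_lebesgue: "finite X \<Longrightarrow> area (convex hull X) = measure lebesgue (convex hull X)"
  by (simp add: finite_imp_compact_convex_hull compact_imp_closed borel_closed measure_completion)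

lemma area_hull_mono:
  assumes "convex hull X \<subseteq> convex hull Y" "finite X" "finite Y"
  shows "area (convex hull X) \<le> area (convex hull Y)"
  using assms measure_mono_fmeasurable[OF assms(1) fmeasurableD[OF lmeasurable_hull] lmeasurable_hull]
  by (simp add: area_eq_lebesgue)

lemma measure_union_across_line:
  assumes X: "finite X" "a \<in> X" "b \<in> X" "\<And>s. s \<in> X \<Longrightarrow> orient s b a \<ge> 0"
    and p: "orient p a b > 0"
  shows "measure lebesgue (convex hull X \<union> convex hull {p, a, b}) = area (convex hull X) + orient p a b / 2"
proof -
  have neq: "b \<noteq> a" using p by (auto simp: orient_def)
  obtain w c where w: "\<And>x. orient x b a = w \<bullet> x + c" "w \<noteq> 0"
    using orient_as_inner[of b a] neq by metis
  have "orient x b a = 0" if x: "x \<in> convex hull X" "x \<in> convex hull {p, a, b}" for x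
  proof (rule antisym)
    show "0 \<le> orient x b a" using orient_hull_ge[OF x(1)] X by auto
    have "orient p b a = - orient p a b" "orient a b a = 0" "orient b b a = 0"
      by (simp_all add: orient_def algebra_simps)
    then show "orient x b a \<le> 0"
      using p by (intro orient_hull_le[OF x(2)]) auto
  qed
  then have "w \<bullet> x + c = 0" if "x \<in> convex hull X" "x \<in> convex hull {p, a, b}" for x
    using that w(1) by metis
  then have "convex hull X \<inter> convex hull {p, a, b} \<subseteq> {x. w \<bullet> x = - c}"
    by (auto simp: eq_neg_iff_add_eq_0)
  then have "negligible (convex hull X \<inter> convex hull {p, a, b})"
    using negligible_hyperplane[of w "-c"] w(2) negligible_subset by blast
  then have "measure lebesgue (convex hull X \<inter> convex hull {p, a, b}) = 0"
    by (simp add: negligible_imp_measure0)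
  then show ?thesis
    using measure_Un3[OF lmeasurable_hull[OF X(1)] lmeasurable_hull, of "{p, a, b}"] X(1) p
    by (simp add: area_eq_lebesgue[symmetric] area_triangle)
qed

text \<open>
  The hull of \<open>X\<close> and the triangle on its boundary segment \<open>ab\<close> overlap only in a line. There may be
  further points in the hull of \<open>insert p X\<close> when \<open>a\<close> and \<open>b\<close> are not the neighbours of \<open>p\<close>, so in
  general there is just an inequality; this is what allows \<open>p\<close> to be moved freely.
\<close>

lemma area_attach_triangle_le:
  assumes X: "finite X" "a \<in> X" "b \<in> X" "\<And>s. s \<in> X \<Longrightarrow> orient s b a \<ge> 0"
    and p: "orient p a b > 0"
  shows "area (convex hull X) + orient p a b / 2 \<le> area (convex hull (insert p X))"
proof -
  have "convex hull X \<union> convex hull {p, a, b} \<subseteq> convex hull (insert p X)"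
    using X by (intro Un_least hull_mono) auto
  then have "measure lebesgue (convex hull X \<union> convex hull {p, a, b}) \<le> measure lebesgue (convex hull (insert p X))"
    using X(1) by (intro measure_mono_fmeasurable) (auto simp: lmeasurable_hull fmeasurableD)
  then show ?thesis
    using measure_union_across_line[OF X p] X(1) by (simp add: area_eq_lebesgue)
qed

text \<open>
  All of \<open>X\<close> lies in the angle at \<open>p\<close> between the rays to \<open>a\<close> and \<open>b\<close>, and beyond the line \<open>ab\<close>. So
  each segment from \<open>p\<close> to a point of the hull of \<open>X\<close> crosses the segment \<open>ab\<close>: up to the crossing it
  runs in the triangle, and from there on in the hull of \<open>X\<close>.
\<close>

lemma hull_cut_ear:
  assumes X: "a \<in> X" "b \<in> X" "\<And>s. s \<in> X \<Longrightarrow> orient s b a \<ge> 0"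
    and cone: "\<And>s. s \<in> X \<Longrightarrow> orient s p a \<ge> 0" "\<And>s. s \<in> X \<Longrightarrow> orient s b p \<ge> 0"
    and p: "orient p a b > 0"
  shows "convex hull (insert p X) = convex hull X \<union> convex hull {p, a, b}"
proof
  show "convex hull X \<union> convex hull {p, a, b} \<subseteq> convex hull (insert p X)"
    using X by (intro Un_least hull_mono) auto
  show "convex hull (insert p X) \<subseteq> convex hull X \<union> convex hull {p, a, b}"
  proof
    fix x assume "x \<in> convex hull (insert p X)"
    then obtain u k where u: "0 \<le> u" "u \<le> 1" and k: "k \<in> convex hull X"
      and x: "x = (1 - u) *\<^sub>R p + u *\<^sub>R k"
      using X(1) by (auto simp: convex_hull_insert_alt split: if_splits)
    have kpos: "orient k b a \<ge> 0" "orient k p a \<ge> 0" "orient k b p \<ge> 0"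
      using orient_hull_ge[OF k] X(3) cone by auto
    let ?D = "orient p a b"
    have cyc: "orient y p a = orient p a y" "orient y b p = orient p y b" "orient y b a = orient a y b" for y
      by (simp_all add: orient_def algebra_simps)
    have scale: "orient p a x = u * orient p a k" "orient p x b = u * orient p k b"
      by (simp_all add: x orient_def algebra_simps)
    show "x \<in> convex hull X \<union> convex hull {p, a, b}"
    proof (cases "orient a x b \<le> 0")
      case True
      then show ?thesis using in_triangle[OF p] kpos u scale by (simp add: cyc)
    next
      case False
      \<comment> \<open>In the coordinates at \<open>p\<close> along \<open>a - p\<close> and \<open>b - p\<close>, the line \<open>ab\<close> is where they sum to 1.
        Hence the point \<open>y\<close> where the segment \<open>pk\<close> crosses \<open>ab\<close> is at the fraction \<open>1 / \<sigma>\<close> of the way,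
        and \<open>x\<close>, being at the fraction \<open>u > 1 / \<sigma>\<close>, lies between \<open>y\<close> and \<open>k\<close>.\<close>
      define \<alpha> where "\<alpha> = orient p k b / ?D"
      define \<beta> where "\<beta> = orient p a k / ?D"
      define \<sigma> where "\<sigma> = \<alpha> + \<beta>"
      have ab: "\<alpha> \<ge> 0" "\<beta> \<ge> 0" using kpos p by (auto simp: \<alpha>_def \<beta>_def cyc)
      have "u * (orient p k b + orient p a k) = ?D + orient a x b"
        unfolding distrib_left scale[symmetric] by (simp add: orient_def algebra_simps)
      then have "u * (orient p k b + orient p a k) > ?D" using False by simp
      then have u\<sigma>: "u * \<sigma> > 1" using p
        by (simp add: \<sigma>_def \<alpha>_def \<beta>_def add_divide_distrib[symmetric] less_divide_eq)
      have \<sigma>1: "\<sigma> > 1"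
      proof (rule ccontr)
        assume "\<not> \<sigma> > 1"
        then have "u * \<sigma> \<le> 1 * 1" using u ab by (intro mult_mono) (auto simp: \<sigma>_def)
        then show False using u\<sigma> by simp
      qed
      define y where "y = (\<alpha> / \<sigma>) *\<^sub>R a + (\<beta> / \<sigma>) *\<^sub>R b"
      have "y \<in> closed_segment a b"
        using ab \<sigma>1 by (auto simp: closed_segment_def y_def \<sigma>_def field_simps intro!: exI[of _ "\<beta> / \<sigma>"])
          (simp add: add_divide_distrib[symmetric] scaleR_add_left[symmetric])
      then have y: "y \<in> convex hull X"
        using X closed_segment_subset_convex_hull[of a X b] by (auto simp: hull_inc)
      have kp: "k = p + \<alpha> *\<^sub>R (a - p) + \<beta> *\<^sub>R (b - p)"
        unfolding \<alpha>_def \<beta>_def using p by (intro barycentric_coordinates) auto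
      have "\<sigma> *\<^sub>R y = \<alpha> *\<^sub>R a + \<beta> *\<^sub>R b" using \<sigma>1 by (simp add: y_def scaleR_add_right)
      then have ky: "k = (1 - \<sigma>) *\<^sub>R p + \<sigma> *\<^sub>R y"
        using kp by (simp add: \<sigma>_def algebra_simps)
      define t where "t = (u * \<sigma> - 1) / (\<sigma> - 1)"
      have t: "0 \<le> t" "t \<le> 1" 
        using u\<sigma> \<sigma>1 u mult_right_mono[of u 1 \<sigma>] by (auto simp: t_def)
      have "(\<sigma> - 1) *\<^sub>R x = (\<sigma> - 1) *\<^sub>R ((1 - t) *\<^sub>R y + t *\<^sub>R k)"
      proof -
        have "(\<sigma> - 1) * t = u * \<sigma> - 1" using \<sigma>1 by (simp add: t_def)
        then have "(\<sigma> - 1) *\<^sub>R ((1 - t) *\<^sub>R y + t *\<^sub>R k) = (\<sigma> - u * \<sigma>) *\<^sub>R y + (u * \<sigma> - 1) *\<^sub>R k"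
          by (simp add: scaleR_add_right right_diff_distrib)
        also have "\<dots> = (\<sigma> - 1) *\<^sub>R x"
          by (simp add: x ky vec_eq_iff algebra_simps)
        finally show ?thesis by (rule sym)
      qed
      then have "x = (1 - t) *\<^sub>R y + t *\<^sub>R k" 
        by (rule scaleR_left_imp_eq[rotated]) (use \<sigma>1 in simp)
      then have "x \<in> convex hull X"
        using y k t convexD_alt[OF convex_convex_hull] by blast
      then show ?thesis by simp
    qed
  qed
qed

lemma area_cut_ear:
  assumes X: "finite X" "a \<in> X" "b \<in> X" "\<And>s. s \<in> X \<Longrightarrow> orient s b a \<ge> 0"
    and cone: "\<And>s. s \<in> X \<Longrightarrow> orient s p a \<ge> 0" "\<And>s. s \<in> X \<Longrightarrow> orient s b p \<ge> 0"
    and p: "orient p a b > 0"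
  shows "area (convex hull (insert p X)) = area (convex hull X) + orient p a b / 2"
  using measure_union_across_line[OF X p] hull_cut_ear[OF X(2-4) cone p] X(1)
    area_eq_lebesgue[of "insert p X"]
  by simp


section \<open>Counterclockwise vertex lists\<close>

text \<open>
  The vertices of a convex polygon in counterclockwise order: every three entries, in the order of the
  list, form a counterclockwise triangle. As \<open>orient\<close> is cyclic, this is invariant under rotations of
  the list.
\<close>

primrec ccw :: "(real^2) list \<Rightarrow> bool" where
  "ccw [] = True"
| "ccw (p # xs) = (sorted_wrt (\<lambda>s t. orient p s t > 0) xs \<and> ccw xs)"

lemma ccw_snoc: "ccw (xs @ [p]) \<longleftrightarrow> ccw (p # xs)"
  by (induction xs) (auto simp: sorted_wrt_append orient_cyclic)

lemma ccw_rotate: "ccw (xs @ ys) \<longleftrightarrow> ccw (ys @ xs)"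
proof (induction xs arbitrary: ys)
  case (Cons x xs)
  show ?case using Cons.IH[of "ys @ [x]"] ccw_snoc[of "xs @ ys" x] by simp
qed simp

lemma ccw_ear:
  assumes "ccw (p # a # ys @ [b])"
  shows "s \<in> set (a # ys @ [b]) \<Longrightarrow> orient s b a \<ge> 0"
    and "s \<in> set (a # ys @ [b]) \<Longrightarrow> orient s p a \<ge> 0"
    and "s \<in> set (a # ys @ [b]) \<Longrightarrow> orient s b p \<ge> 0"
    and "orient p a b > 0"
proof -
  have pos: "orient p a b > 0" "\<And>t. t \<in> set ys \<Longrightarrow> orient a t b > 0 \<and> orient p a t > 0 \<and> orient p t b > 0"
    using assms by (auto simp: sorted_wrt_append)
  then show "orient p a b > 0" by simp
  assume s: "s \<in> set (a # ys @ [b])"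
  then have "orient a s b \<ge> 0" "orient p a s \<ge> 0" "orient p s b \<ge> 0"
    using pos by (auto simp: less_imp_le)
  then show "orient s b a \<ge> 0" "orient s p a \<ge> 0" "orient s b p \<ge> 0"
    using orient_cyclic by metis+
qed

lemma area_ccw_cut_ear:
  assumes "ccw (p # a # ys @ [b])"
  shows "area (convex hull (set (p # a # ys @ [b]))) =
    area (convex hull (set (a # ys @ [b]))) + orient p a b / 2"
  using area_cut_ear[of "set (a # ys @ [b])" a b p] ccw_ear[OF assms] by simp

lemma hd_notin_hull_ccw:
  assumes "ccw (p # xs)" "distinct (p # xs)"
  shows "p \<notin> convex hull (set xs)"
proof (cases xs)
  case (Cons a zs)
  show ?thesis
  proof (cases zs rule: rev_cases)
    case Nil
    then show ?thesis using Cons assms by simp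
  next
    case (snoc ys b)
    then have ccw: "ccw (p # a # ys @ [b])" using Cons assms by simp
    have "orient p b a = - orient p a b" by (simp add: orient_def algebra_simps)
    then have "orient p b a < 0" using ccw_ear(4)[OF ccw] by simp
    then show ?thesis
      using orient_hull_ge[of p "set xs" 0 b a] ccw_ear(1)[OF ccw] Cons snoc by force
  qed
qed simp

lemma ccw_convex_independent:
  assumes "ccw xs" "distinct xs" "x \<in> set xs"
  shows "x \<notin> convex hull (set xs - {x})"
proof -
  obtain us vs where xs: "xs = us @ x # vs" using split_list[OF assms(3)] by blast
  have "ccw (x # vs @ us)" using assms(1) ccw_rotate[of us "x # vs"] xs by simp
  moreover have "distinct (x # vs @ us)" using assms(2) xs by auto
  moreover have "set xs - {x} = set (vs @ us)" using assms(2) xs by auto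
  ultimately show ?thesis using hd_notin_hull_ccw by metis
qed

text \<open>
  As \<open>t\<close> lies in the angle at \<open>p\<close> between the rays to \<open>s\<close> and \<open>u\<close> but not in the triangle \<open>p s u\<close>, it
  lies beyond the line \<open>su\<close>.
\<close>

lemma convex_independent_orient:
  assumes "orient p s t > 0" "orient p t u > 0" "orient p s u > 0"
    and "t \<notin> convex hull (X - {t})" "{p, s, u} \<subseteq> X"
  shows "orient s t u > 0"
proof (rule ccontr)
  assume "\<not> orient s t u > 0"
  then have "t \<in> convex hull {p, s, u}"
    using assms by (intro in_triangle) auto
  moreover have "{p, s, u} \<subseteq> X - {t}" using assms by auto
  ultimately show False using assms(4) hull_mono by blast
qed

lemma ccw_of_sorted_around:
  assumes "sorted_wrt (\<lambda>s t. orient p s t > 0) xs" "insert p (set xs) \<subseteq> X"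
    and "\<And>t. t \<in> X \<Longrightarrow> t \<notin> convex hull (X - {t})"
  shows "ccw xs"
  using assms
proof (induction xs)
  case (Cons s xs)
  have "sorted_wrt (\<lambda>t u. orient s t u > 0) xs"
  proof (rule sorted_wrt_mono_rel)
    show "sorted_wrt (\<lambda>t u. orient p t u > 0) xs" using Cons.prems by simp
    show "orient s t u > 0" if "t \<in> set xs" "u \<in> set xs" "orient p t u > 0" for t u
      using Cons.prems that by (intro convex_independent_orient[of p s t u X]) auto
  qed
  then show ?case using Cons by simp
qed simp

text \<open>
  Points in convex position can be listed counterclockwise from any one of them, \<open>p\<close>. A line separates
  \<open>p\<close> from the other points, so these have well-defined slopes as seen from \<open>p\<close>, with respect to the
  normal \<open>w\<close> of the line. Sorting by slope is sorting by angle around \<open>p\<close>, and convex position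
  takes care of the triples that do not contain \<open>p\<close>.
\<close>

lemma ccw_enumeration:
  assumes X: "finite X" "\<And>t. t \<in> X \<Longrightarrow> t \<notin> convex hull (X - {t})" and p: "p \<in> X"
  obtains xs where "X = set (p # xs)" "distinct (p # xs)" "ccw (p # xs)"
proof -
  have "closed (convex hull (X - {p}))"
    using X(1) by (simp add: finite_imp_compact_convex_hull compact_imp_closed)
  then obtain w c where w: "w \<bullet> p < c" "\<And>x. x \<in> convex hull (X - {p}) \<Longrightarrow> w \<bullet> x > c"
    using separating_hyperplane_closed_point[of "convex hull (X - {p})" p] X(2)[OF p] by auto
  have pos: "w \<bullet> (s - p) > 0" if "s \<in> X - {p}" for s
    using w(1) w(2)[of s] that by (simp add: hull_inc inner_diff_right)
  define key where "key s = (w$1 * (s - p)$2 - w$2 * (s - p)$1) / (w \<bullet> (s - p))" for s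
  have key_diff: "(w \<bullet> w) * orient p s t = (key t - key s) * ((w \<bullet> (s - p)) * (w \<bullet> (t - p)))"
    if "s \<in> X - {p}" "t \<in> X - {p}" for s t
  proof -
    have "(key t - key s) * ((w \<bullet> (s - p)) * (w \<bullet> (t - p))) =
       (key t * (w \<bullet> (t - p))) * (w \<bullet> (s - p)) - (key s * (w \<bullet> (s - p))) * (w \<bullet> (t - p))"
      by (simp add: algebra_simps)
    also have "\<dots> = (w$1 * (t - p)$2 - w$2 * (t - p)$1) * (w \<bullet> (s - p))
       - (w$1 * (s - p)$2 - w$2 * (s - p)$1) * (w \<bullet> (t - p))"
      using pos[OF that(1)] pos[OF that(2)] by (simp add: key_def)
    also have "\<dots> = (w \<bullet> w) * orient p s t"
      by (simp add: inner_vec_def sum_2 orient_def algebra_simps)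
    finally show ?thesis by simp
  qed
  \<comment> \<open>Two points of equal slope are on one ray from \<open>p\<close>, and the nearer one is then in the hull of
    \<open>p\<close> and the farther one.\<close>
  have no_overtake: False
    if st: "s \<in> X - {p}" "t \<in> X - {p}" "s \<noteq> t" "key s = key t" "w \<bullet> (s - p) \<le> w \<bullet> (t - p)" for s t
  proof -
    have "w \<noteq> 0" using pos[OF st(1)] by auto
    then have "orient p s t = 0" using key_diff[OF st(1,2)] st(4) by simp
    then have 0: "(s - p)$1 * (t - p)$2 = (s - p)$2 * (t - p)$1" by (simp add: orient_def)
    have "(w \<bullet> (t - p)) *\<^sub>R (s - p) = (w \<bullet> (s - p)) *\<^sub>R (t - p)"
      using 0 by (simp add: vec_eq_iff forall_2 inner_vec_def sum_2 distrib_right mult.assoc mult.left_commute)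
        (simp add: algebra_simps)
    define r where "r = (w \<bullet> (s - p)) / (w \<bullet> (t - p))"
    have r: "0 \<le> r" "r \<le> 1" using pos[OF st(1)] pos[OF st(2)] st(5) by (auto simp: r_def)
    have "(w \<bullet> (t - p)) *\<^sub>R (s - p) = (w \<bullet> (t - p)) *\<^sub>R (r *\<^sub>R (t - p))"
      using \<open>_ *\<^sub>R (s - p) = _\<close> pos[OF st(2)] by (simp add: r_def)
    then have "s - p = r *\<^sub>R (t - p)" using pos[OF st(2)] by (simp only: scaleR_cancel_left) simp
    then have "s = (1 - r) *\<^sub>R p + r *\<^sub>R t" by (simp add: algebra_simps)
    then have "s \<in> closed_segment p t" using r by (auto simp: in_segment)
    moreover have "closed_segment p t \<subseteq> convex hull (X - {s})"
      unfolding segment_convex_hull using st p by (intro hull_mono) auto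
    ultimately show False using X(2) st(1) by blast
  qed
  have key_inj: "key s \<noteq> key t" if "s \<in> X - {p}" "t \<in> X - {p}" "s \<noteq> t" for s t
    using no_overtake[of s t] no_overtake[of t s] that by (metis linear)
  obtain ys where ys: "set ys = X - {p}" "distinct ys"
    using finite_distinct_list[of "X - {p}"] X(1) by auto
  define xs where "xs = sort_key key ys"
  have xs: "set xs = X - {p}" "distinct xs" using ys by (auto simp: xs_def)
  have sorted: "sorted (map key xs)" by (simp add: xs_def)
  have around: "sorted_wrt (\<lambda>s t. orient p s t > 0) xs"
    unfolding sorted_wrt_iff_nth_less
  proof (intro allI impI)
    fix i j assume ij: "i < j" "j < length xs"
    have mem: "xs ! i \<in> X - {p}" "xs ! j \<in> X - {p}" using ij xs(1) nth_mem[of _ xs] by auto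
    have "xs ! i \<noteq> xs ! j" using ij xs(2) by (simp add: nth_eq_iff_index_eq)
    moreover have "key (xs ! i) \<le> key (xs ! j)" using sorted_nth_mono[OF sorted, of i j] ij by simp
    ultimately have "key (xs ! i) < key (xs ! j)" using key_inj[OF mem] by simp
    then have "(w \<bullet> w) * orient p (xs ! i) (xs ! j) > 0"
      using key_diff[OF mem] pos[OF mem(1)] pos[OF mem(2)] by simp
    then show "orient p (xs ! i) (xs ! j) > 0"
      using zero_less_mult_pos inner_ge_zero[of w] by (metis less_eq_real_def mult_zero_left less_irrefl)
  qed
  show thesis
  proof (rule that[of xs])
    show "X = set (p # xs)" "distinct (p # xs)" using xs p by auto
    show "ccw (p # xs)" using around ccw_of_sorted_around[OF around, of X] X(2) xs p by auto
  qed
qed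

section \<open>Largest inscribed polygons use the vertices of the outer polygon\<close>

lemma area_hull_short:
  assumes "length xs \<le> 2"
  shows "area (convex hull (set xs)) = 0"
proof (cases xs)
  case (Cons a ys)
  obtain b where "set xs = {a, a, b}"
    using assms Cons by (cases ys) auto
  then show ?thesis using area_triangle[of a a b] by simp
qed simp

text \<open>
  Points of \<open>X\<close> that are not vertices of its hull are dropped. If \<open>X\<close> is in convex position and has at
  least three points, a point \<open>p \<in> X - V\<close> with neighbours \<open>a\<close> and \<open>b\<close> is moved to a point of \<open>V\<close> where the signed area of the
  triangle \<open>p a b\<close>, an affine function of \<open>p\<close>, is at least as large. The remaining points stay
  fixed. Either step decreases the sum of the numbers of points in \<open>X\<close> and in \<open>X - V\<close>.
\<close>

lemma area_le_vertex_hull: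
  assumes V: "finite V"
  shows "finite X \<Longrightarrow> X \<subseteq> convex hull V \<Longrightarrow>
    \<exists>Y \<subseteq> V. card Y \<le> card X \<and> area (convex hull X) \<le> area (convex hull Y)"
proof (induction "card X + card (X - V)" arbitrary: X rule: less_induct)
  case less
  show ?case
  proof (cases "\<exists>x\<in>X. x \<in> convex hull (X - {x})")
    case True
    then obtain x where x: "x \<in> X" "x \<in> convex hull (X - {x})" by blast
    have "convex hull X = convex hull (X - {x})"
      using hull_redundant_eq[of x convex "X - {x}"] x by (simp add: insert_absorb)
    moreover have "card (X - {x}) < card X" using x less.prems by (metis card_Diff1_less)
    moreover have "card (X - {x} - V) \<le> card (X - V)"
      using less.prems by (intro card_mono) auto
    ultimately obtain Y where "Y \<subseteq> V" "card Y \<le> card (X - {x})" "area (convex hull X) \<le> area (convex hull Y)"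
      using less.hyps[of "X - {x}"] less.prems by auto
    then show ?thesis using \<open>card (X - {x}) < card X\<close> by (meson le_trans less_imp_le)
  next
    case indep: False
    show ?thesis
    proof (cases "X \<subseteq> V")
      case False
      then obtain p where p: "p \<in> X" "p \<notin> V" by blast
      obtain xs where xs: "X = set (p # xs)" "distinct (p # xs)" "ccw (p # xs)"
        using ccw_enumeration[of X p] less.prems indep p by blast
      show ?thesis
      proof (cases "length (p # xs) \<le> 2")
        case True
        then have "area (convex hull X) = 0" unfolding xs(1) by (rule area_hull_short)
        then show ?thesis by (intro exI[of _ "{}"]) simp
      next
        case False
        then obtain a ys b where ab: "xs = a # ys @ [b]"
          by (cases xs; cases "tl xs" rule: rev_cases) auto
        have ccw: "ccw (p # a # ys @ [b])" using xs ab by simp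
        obtain v where v: "v \<in> V" "orient v a b \<ge> orient p a b"
          using orient_hull_maximal[of p V a b] p less.prems by blast
        have "area (convex hull X) = area (convex hull (set xs)) + orient p a b / 2"
          using area_ccw_cut_ear[OF ccw] xs(1) ab by simp
        also have "\<dots> \<le> area (convex hull (set xs)) + orient v a b / 2" using v by simp
        also have "\<dots> \<le> area (convex hull (insert v (set xs)))"
          using ccw_ear[OF ccw] v ab by (intro area_attach_triangle_le) auto
        finally have le: "area (convex hull X) \<le> area (convex hull (insert v (set xs)))" .
        have card: "card (insert v (set xs)) \<le> card X"
          using xs by (simp add: card_insert_if)
        have "insert v (set xs) - V \<subset> X - V" using xs p v by auto
        then have "card (insert v (set xs) - V) < card (X - V)"
          using less.prems by (intro psubset_card_mono) auto
        then have "card (insert v (set xs)) + card (insert v (set xs) - V) < card X + card (X - V)"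
          using card by linarith
        moreover have "insert v (set xs) \<subseteq> convex hull V"
          using v less.prems xs(1) by (auto simp: hull_inc)
        ultimately obtain Y where "Y \<subseteq> V" "card Y \<le> card (insert v (set xs))"
          "area (convex hull (insert v (set xs))) \<le> area (convex hull Y)"
          using less.hyps[of "insert v (set xs)"] by auto
        then show ?thesis using le card by (meson order_trans)
      qed
    qed blast
  qed
qed

section \<open>The maximal ratio as a finite maximum\<close>

lemma convex_ngon_hull:
  assumes "convex_ngon n P"
  defines "V \<equiv> {v. v extreme_point_of P}"
  shows "P = convex hull V" "finite V" "card V = n" "\<And>v. v \<in> V \<Longrightarrow> v \<notin> convex hull (V - {v})"
proof -
  have "polytope P" "card V = n" using assms by (auto simp: convex_ngon_def)
  then show "card V = n" by simp
  obtain W where W: "finite W" "P = convex hull W" using \<open>polytope P\<close> by (auto simp: polytope_def)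
  show "finite V" using W extreme_points_of_convex_hull[of W] unfolding V_def by (meson finite_subset)
  show P: "P = convex hull V" unfolding V_def
    using \<open>polytope P\<close> by (intro Krein_Milman_Minkowski polytope_imp_compact polytope_imp_convex)
  show "v \<notin> convex hull (V - {v})" if "v \<in> V" for v
  proof
    assume "v \<in> convex hull (V - {v})"
    then have "P = convex hull (V - {v})"
      using P hull_redundant_eq[of v convex "V - {v}"] that by (simp add: insert_absorb)
    then show False using that extreme_point_of_convex_hull[of v "V - {v}"] by (auto simp: V_def)
  qed
qed

lemma convex_ngon_of_independent:
  assumes "finite Y" "\<And>v. v \<in> Y \<Longrightarrow> v \<notin> convex hull (Y - {v})"
  shows "convex_ngon (card Y) (convex hull Y)" "{v. v extreme_point_of convex hull Y} = Y"
proof -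
  show "{v. v extreme_point_of convex hull Y} = Y"
    using extreme_point_of_convex_hull_convex_independent[of Y] assms by (auto simp: finite_imp_compact)
  then show "convex_ngon (card Y) (convex hull Y)"
    using assms(1) by (auto simp: convex_ngon_def polytope_def)
qed

text \<open>
  A selection of fewer than \<open>m\<close> vertices, as it may result from moving the vertices of an \<open>m\<close>-gon, is
  contained in one of exactly \<open>m\<close>, whose hull is a genuine \<open>m\<close>-gon. So the largest hull of \<open>m\<close> vertices
  attains the maximum.
\<close>

lemma max_ratio_vertices:
  assumes P: "convex_ngon n P" and m: "m \<le> n"
  defines "V \<equiv> {v. v extreme_point_of P}"
  shows "\<exists>Y. Y \<subseteq> V \<and> card Y = m \<and> max_ratio m P = area (convex hull Y) / area P"
    and "Z \<subseteq> V \<Longrightarrow> card Z = m \<Longrightarrow> area (convex hull Z) / area P \<le> max_ratio m P"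
proof -
  note V = convex_ngon_hull[OF P, folded V_def]
  define \<F> where "\<F> = {Y. Y \<subseteq> V \<and> card Y = m}"
  have fin: "finite \<F>" using V(2) by (simp add: \<F>_def)
  have "\<F> \<noteq> {}" using m V(3) obtain_subset_with_card_n[of m V] by (auto simp: \<F>_def)
  then obtain Y where Y: "Y \<in> \<F>" and Ymax: "\<And>Z. Z \<in> \<F> \<Longrightarrow> area (convex hull Z) \<le> area (convex hull Y)"
    using finite_has_maximal[of "(\<lambda>Y. area (convex hull Y)) ` \<F>"] fin
    by (metis (no_types, lifting) finite_imageI image_iff image_is_empty linorder_linear)
  have "max_ratio m P = area (convex hull Y) / area P"
    unfolding max_ratio_def
  proof (rule Greatest_equality)
    have "finite Y" using Y V(2) finite_subset by (auto simp: \<F>_def)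
    moreover have "v \<notin> convex hull (Y - {v})" if "v \<in> Y" for v
      using V(4)[of v] Y that hull_mono[of "Y - {v}" "V - {v}" convex] by (auto simp: \<F>_def)
    ultimately have "convex_ngon m (convex hull Y)"
      using convex_ngon_of_independent(1)[of Y] Y by (auto simp: \<F>_def)
    moreover have "convex hull Y \<subseteq> P" using Y hull_mono[of Y V convex] V(1) by (simp add: \<F>_def)
    ultimately show "\<exists>Q. convex_ngon m Q \<and> Q \<subseteq> P \<and> area (convex hull Y) / area P = area Q / area P"
      by blast
  next
    fix r assume "\<exists>Q. convex_ngon m Q \<and> Q \<subseteq> P \<and> r = area Q / area P"
    then obtain Q where Q: "convex_ngon m Q" "Q \<subseteq> P" "r = area Q / area P" by blast
    define X where "X = {v. v extreme_point_of Q}"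
    note X = convex_ngon_hull[OF Q(1), folded X_def]
    have "X \<subseteq> convex hull V" using Q(2) V(1) by (auto simp: X_def extreme_point_of_def)
    then obtain Z where Z: "Z \<subseteq> V" "card Z \<le> m" "area Q \<le> area (convex hull Z)"
      using area_le_vertex_hull[OF V(2) X(2)] X(1,3) by metis
    obtain Z' where Z': "Z \<subseteq> Z'" "Z' \<subseteq> V" "card Z' = m"
      using exists_subset_between[of Z m V] Z m V by auto
    have "area (convex hull Z) \<le> area (convex hull Z')"
      using Z' V(2) by (intro area_hull_mono hull_mono) (auto intro: finite_subset)
    also have "\<dots> \<le> area (convex hull Y)" using Z' by (intro Ymax) (simp add: \<F>_def)
    finally show "r \<le> area (convex hull Y) / area P"
      using Z(3) Q(3) by (simp add: divide_right_mono)
  qed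
  then show "\<exists>Y. Y \<subseteq> V \<and> card Y = m \<and> max_ratio m P = area (convex hull Y) / area P"
    and "Z \<subseteq> V \<Longrightarrow> card Z = m \<Longrightarrow> area (convex hull Z) / area P \<le> max_ratio m P"
    using Y Ymax[of Z] by (auto simp: \<F>_def divide_right_mono)
qed

section \<open>The smallest ear of a hexagon\<close>

lemma diagonals_cross:
  assumes "orient a b c > 0" "orient a b d > 0" "orient a c d > 0" "orient b c d > 0"
  obtains x r s where "0 \<le> r" "r \<le> 1" "0 \<le> s" "s \<le> 1"
    "x = (1 - r) *\<^sub>R a + r *\<^sub>R c" "x = (1 - s) *\<^sub>R b + s *\<^sub>R d"
proof -
  define D where "D = orient a b d + orient b c d"
  have D: "D > 0" "D = orient a b c + orient a c d"
    using assms by (auto simp: D_def) (simp add: orient_def algebra_simps)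
  define r where "r = orient a b d / D"
  define s where "s = orient a b c / D"
  have "D *\<^sub>R ((1 - r) *\<^sub>R a + r *\<^sub>R c) = (D - orient a b d) *\<^sub>R a + orient a b d *\<^sub>R c"
    using D(1) by (simp add: r_def scaleR_add_right right_diff_distrib)
  also have "\<dots> = (D - orient a b c) *\<^sub>R b + orient a b c *\<^sub>R d"
    by (simp add: vec_eq_iff forall_2 D_def orient_def algebra_simps)
  also have "\<dots> = D *\<^sub>R ((1 - s) *\<^sub>R b + s *\<^sub>R d)"
    using D(1) by (simp add: s_def scaleR_add_right right_diff_distrib)
  finally have "(1 - r) *\<^sub>R a + r *\<^sub>R c = (1 - s) *\<^sub>R b + s *\<^sub>R d"
    using D(1) by (simp only: scaleR_cancel_left) simp
  moreover have "0 \<le> r" "r \<le> 1" "0 \<le> s" "s \<le> 1"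
    using assms D D_def by (auto simp: r_def s_def)
  ultimately show thesis using that by blast
qed

lemma area_hexagon:
  assumes "ccw [a, b, c, d, e, f]"
  shows "area (convex hull {a, b, c, d, e, f}) =
    (orient a b f + orient b c f + orient c d f + orient d e f) / 2"
  using area_ccw_cut_ear[of a b "[c, d, e]" f] area_ccw_cut_ear[of b c "[d, e]" f]
    area_ccw_cut_ear[of c d "[e]" f] area_ccw_cut_ear[of d e "[]" f] area_hull_short[of "[e, f]"] assms
  by simp

lemma convex_bound_ge:
  fixes x y m :: real
  assumes "m \<le> x" "m \<le> y" "0 \<le> u" "u \<le> 1"
  shows "m \<le> (1 - u) * x + u * y"
  using convex_bound_le[of "-x" "-m" "-y" "1 - u" u] assms by simp

lemma orient_segment_ge:
  assumes "m \<le> orient x a b" "m \<le> orient y a b" "0 \<le> u" "u \<le> 1"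
  shows "m \<le> orient ((1 - u) *\<^sub>R x + u *\<^sub>R y) a b"
  unfolding orient_convex_combination using assms by (rule convex_bound_ge)

lemma orient_collinear:
  "orient ((1 - u) *\<^sub>R x + u *\<^sub>R y) ((1 - s) *\<^sub>R x + s *\<^sub>R y) ((1 - t) *\<^sub>R x + t *\<^sub>R y) = 0"
  by (simp add: orient_def algebra_simps)

text \<open>
  The sum in the conclusion is twice the area of the hexagon, which is tiled by six triangles over its
  sides, each at least as large as some ear, and the central triangle of the main diagonals. Instead
  of showing that these triangles do not overlap, the proof checks that their signed areas add up and that the central one is nonnegative as well.
\<close>

lemma hexagon_least_ear:
  assumes ccw: "ccw [a, b, c, d, e, f]"
    and ears: "m \<le> orient f a b" "m \<le> orient a b c" "m \<le> orient b c d"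
      "m \<le> orient c d e" "m \<le> orient d e f" "m \<le> orient e f a"
  shows "6 * m \<le> orient a b f + orient b c f + orient c d f + orient d e f"
proof -
  have P: "orient a c d > 0" "orient a c f > 0" "orient a d f > 0" "orient c d f > 0"
    and Q: "orient a b d > 0" "orient a b e > 0" "orient a d e > 0" "orient b d e > 0"
    and R: "orient b c e > 0" "orient b c f > 0" "orient b e f > 0" "orient c e f > 0"
    using ccw by auto
  obtain p r1 r2 where p: "0 \<le> r1" "r1 \<le> 1" "0 \<le> r2" "r2 \<le> 1"
    "p = (1 - r1) *\<^sub>R a + r1 *\<^sub>R d" "p = (1 - r2) *\<^sub>R c + r2 *\<^sub>R f"
    using diagonals_cross[OF P] by metis
  obtain q s1 s2 where q: "0 \<le> s1" "s1 \<le> 1" "0 \<le> s2" "s2 \<le> 1"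
    "q = (1 - s1) *\<^sub>R a + s1 *\<^sub>R d" "q = (1 - s2) *\<^sub>R b + s2 *\<^sub>R e"
    using diagonals_cross[OF Q] by metis
  obtain r t1 t2 where r: "0 \<le> t1" "t1 \<le> 1" "0 \<le> t2" "t2 \<le> 1"
    "r = (1 - t1) *\<^sub>R b + t1 *\<^sub>R e" "r = (1 - t2) *\<^sub>R c + t2 *\<^sub>R f"
    using diagonals_cross[OF R] by metis
  have "m \<le> orient p a b"
    unfolding p(6) by (rule orient_segment_ge) (use p ears orient_cyclic in metis)+
  moreover have "m \<le> orient p b c"
    unfolding p(5) by (rule orient_segment_ge) (use p ears orient_cyclic in metis)+
  moreover have "m \<le> orient r c d"
    unfolding r(5) by (rule orient_segment_ge) (use r ears orient_cyclic in metis)+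
  moreover have "m \<le> orient r d e"
    unfolding r(6) by (rule orient_segment_ge) (use r ears orient_cyclic in metis)+
  moreover have "m \<le> orient q e f"
    unfolding q(5) by (rule orient_segment_ge) (use q ears orient_cyclic in metis)+
  moreover have "m \<le> orient q f a"
    unfolding q(6) by (rule orient_segment_ge) (use q ears orient_cyclic in metis)+
  \<comment> \<open>These triples lie on the main diagonals; they close the gaps of the tiling at \<open>c\<close>, \<open>e\<close> and \<open>a\<close>.\<close>
  moreover have "orient c r p = 0" "orient e q r = 0" "orient a p q = 0"
    using orient_collinear[of 0 c f t2 r2] orient_collinear[of 1 b e s2 t1] orient_collinear[of 0 a d r1 s1]
      p(5,6) q(5,6) r(5,6) by simp_all
  \<comment> \<open>The directions of \<open>ad\<close>, \<open>be\<close>, \<open>cf\<close> turn counterclockwise in this order. As the sides of the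
    central triangle have these directions, its side vectors \<open>p - q\<close> along \<open>ad\<close> and \<open>r - q\<close> along
    \<open>be\<close> cannot be multiples of opposite signs.\<close>
  moreover have "orient p r q \<ge> 0"
  proof -
    define K where "K = orient 0 (d - a) (e - b)"
    define L where "L = orient 0 (e - b) (f - c)"
    define M where "M = orient 0 (d - a) (f - c)"
    have "K = orient a d e + orient a b d" "L = orient b e f + orient b c e" "M = orient a d f + orient a c d"
      by (simp_all add: K_def L_def M_def orient_def algebra_simps)
    then have KLM: "K > 0" "L > 0" "M > 0" using P Q R by simp_all
    define u where "u = r1 - s1"
    define v where "v = t1 - s2"
    have pq: "p - q = u *\<^sub>R (d - a)" unfolding p(5) q(5) by (simp add: u_def algebra_simps)
    have rq: "r - q = v *\<^sub>R (e - b)" unfolding r(5) q(6) by (simp add: v_def algebra_simps)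
    have pr: "p - r = (r2 - t2) *\<^sub>R (f - c)" unfolding r(6) p(6) by (simp add: algebra_simps)
    have "u * M - v * L = orient 0 (u *\<^sub>R (d - a) - v *\<^sub>R (e - b)) (f - c)"
      by (simp add: M_def L_def orient_def algebra_simps)
    also have "u *\<^sub>R (d - a) - v *\<^sub>R (e - b) = (r2 - t2) *\<^sub>R (f - c)"
      using pq rq pr by (metis diff_diff_eq2 diff_add_cancel)
    also have "orient 0 \<dots> (f - c) = 0" by (simp add: orient_def)
    finally have "u * M = v * L" by simp
    then have "(u * v) * M = v\<^sup>2 * L" by (simp add: power2_eq_square algebra_simps)
    then have "(u * v) * M \<ge> 0" using KLM by simp
    then have "u * v \<ge> 0" using KLM(3) by (simp add: zero_le_mult_iff)
    have "orient p r q = orient 0 (p - q) (r - q)" by (simp add: orient_def algebra_simps)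
    also have "\<dots> = (u * v) * K" unfolding pq rq by (simp add: K_def orient_def algebra_simps)
    finally show ?thesis using \<open>u * v \<ge> 0\<close> KLM by simp
  qed
  moreover have "orient a b f + orient b c f + orient c d f + orient d e f =
     orient p a b + orient p b c + orient r c d + orient r d e + orient q e f + orient q f a
     + orient c r p + orient e q r + orient a p q + orient p r q"
    by (simp add: orient_def algebra_simps)
  ultimately show ?thesis by linarith
qed

section \<open>The extremal ratio for hexagons\<close>

lemma area_hexagon_delete_first:
  assumes "ccw [a, b, c, d, e, f]" "distinct [a, b, c, d, e, f]"
  shows "area (convex hull ({a, b, c, d, e, f} - {a})) =
    area (convex hull {a, b, c, d, e, f}) - orient f a b / 2"
proof -
  have "{a, b, c, d, e, f} - {a} = {b, c, d, e, f}" using assms(2) by auto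
  then show ?thesis
    using area_ccw_cut_ear[of a b "[c, d, e]" f] assms(1) orient_cyclic[of a b f] by simp
qed

lemma area_hexagon_delete:
  assumes ccw: "ccw [a, b, c, d, e, f]" and dist: "distinct [a, b, c, d, e, f]"
  defines "V \<equiv> {a, b, c, d, e, f}"
  shows "area (convex hull (V - {a})) = area (convex hull V) - orient f a b / 2"
    and "area (convex hull (V - {b})) = area (convex hull V) - orient a b c / 2"
    and "area (convex hull (V - {c})) = area (convex hull V) - orient b c d / 2"
    and "area (convex hull (V - {d})) = area (convex hull V) - orient c d e / 2"
    and "area (convex hull (V - {e})) = area (convex hull V) - orient d e f / 2"
    and "area (convex hull (V - {f})) = area (convex hull V) - orient e f a / 2"
proof -
  have rot: "ccw [b, c, d, e, f, a]" "ccw [c, d, e, f, a, b]" "ccw [d, e, f, a, b, c]"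
    "ccw [e, f, a, b, c, d]" "ccw [f, a, b, c, d, e]"
    using ccw ccw_rotate[of "[a]" "[b, c, d, e, f]"] ccw_rotate[of "[a, b]" "[c, d, e, f]"]
      ccw_rotate[of "[a, b, c]" "[d, e, f]"] ccw_rotate[of "[a, b, c, d]" "[e, f]"]
      ccw_rotate[of "[a, b, c, d, e]" "[f]"]
    by (simp_all only: append.simps)
  have V: "V = {b, c, d, e, f, a}" "V = {c, d, e, f, a, b}" "V = {d, e, f, a, b, c}"
    "V = {e, f, a, b, c, d}" "V = {f, a, b, c, d, e}"
    by (auto simp: V_def)
  show "area (convex hull (V - {a})) = area (convex hull V) - orient f a b / 2"
    unfolding V_def using area_hexagon_delete_first[OF ccw dist] .
  show "area (convex hull (V - {b})) = area (convex hull V) - orient a b c / 2"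
    unfolding V(1) using dist by (intro area_hexagon_delete_first rot) auto
  show "area (convex hull (V - {c})) = area (convex hull V) - orient b c d / 2"
    unfolding V(2) using dist by (intro area_hexagon_delete_first rot) auto
  show "area (convex hull (V - {d})) = area (convex hull V) - orient c d e / 2"
    unfolding V(3) using dist by (intro area_hexagon_delete_first rot) auto
  show "area (convex hull (V - {e})) = area (convex hull V) - orient d e f / 2"
    unfolding V(4) using dist by (intro area_hexagon_delete_first rot) auto
  show "area (convex hull (V - {f})) = area (convex hull V) - orient e f a / 2"
    unfolding V(5) using dist by (intro area_hexagon_delete_first rot) auto
qed

text \<open>
Deleting the tip of the smallest ear keeps at least five sixths of the area.
\<close>

lemma max_ratio_hexagon_ge:
  assumes P: "convex_ngon 6 P"
  shows "5 / 6 \<le> max_ratio 5 P"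
proof -
  define V where "V = {v. v extreme_point_of P}"
  note V = convex_ngon_hull[OF P, folded V_def]
  obtain a where "a \<in> V" using V(3) by force
  then obtain xs where xs: "V = set (a # xs)" "distinct (a # xs)" "ccw (a # xs)"
    using ccw_enumeration[of V a] V by blast
  then have "length xs = 5" using V(3) distinct_card[of "a # xs"] by simp
  then obtain b c d e f where "xs = [b, c, d, e, f]"
    by (auto simp: length_Suc_conv numeral_eq_Suc)
  then have ccw: "ccw [a, b, c, d, e, f]" and dist: "distinct [a, b, c, d, e, f]"
    and Veq: "V = {a, b, c, d, e, f}" using xs by auto
  define S where "S = orient a b f + orient b c f + orient c d f + orient d e f"
  have area: "area P = S / 2" using area_hexagon[OF ccw] V(1) by (simp add: S_def Veq[symmetric])
  have "S > 0" using ccw by (simp add: S_def)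
  have "\<exists>v\<in>V. 5 / 6 * area P \<le> area (convex hull (V - {v}))"
  proof (rule ccontr)
    assume "\<not> ?thesis"
    then have small: "area (convex hull (V - {v})) < 5 / 6 * area P" if "v \<in> V" for v
      using that by force
    define m where "m = Min {orient f a b, orient a b c, orient b c d, orient c d e, orient d e f, orient e f a}"
    have mem: "a \<in> V" "b \<in> V" "c \<in> V" "d \<in> V" "e \<in> V" "f \<in> V" by (simp_all add: Veq)
    note del = area_hexagon_delete[OF ccw dist, folded Veq, folded V(1)]
    have "orient f a b > S / 6" using small[OF mem(1)] del(1) area by linarith
    moreover have "orient a b c > S / 6" using small[OF mem(2)] del(2) area by linarith
    moreover have "orient b c d > S / 6" using small[OF mem(3)] del(3) area by linarith
    moreover have "orient c d e > S / 6" using small[OF mem(4)] del(4) area by linarith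
    moreover have "orient d e f > S / 6" using small[OF mem(5)] del(5) area by linarith
    moreover have "orient e f a > S / 6" using small[OF mem(6)] del(6) area by linarith
    ultimately have "m > S / 6" by (simp add: m_def)
    moreover have "6 * m \<le> S" unfolding S_def by (rule hexagon_least_ear[OF ccw]) (auto simp: m_def)
    ultimately show False by simp
  qed
  then obtain v where v: "v \<in> V" "5 / 6 * area P \<le> area (convex hull (V - {v}))" by blast
  have "5 / 6 \<le> area (convex hull (V - {v})) / area P"
    using v(2) area \<open>S > 0\<close> by (simp add: field_simps)
  also have "\<dots> \<le> max_ratio 5 P"
    using max_ratio_vertices(2)[OF P, of 5 "V - {v}", folded V_def] v(1) V(2,3) by simp
  finally show ?thesis .
qed

text \<open>
  The hexagon below is an affine image of the regular one, with area 3 and six ears of area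
  \<open>1/2\<close>, so each choice of five vertices spans area \<open>5/2\<close>.
\<close>

lemma affine_regular_hexagon_ratio:
  obtains P where "convex_ngon 6 P" "max_ratio 5 P = 5 / 6"
proof -
  define a b c d e f :: "real^2" where pts: "a = vector [1, 0]" "b = vector [1, 1]" "c = vector [0, 1]"
     "d = vector [-1, 0]" "e = vector [-1, -1]" "f = vector [0, -1]"
  have ccw: "ccw [a, b, c, d, e, f]" by (simp add: pts orient_def)
  have dist: "distinct [a, b, c, d, e, f]" by (simp add: pts vec_eq_iff forall_2)
  define V where "V = {a, b, c, d, e, f}"
  have fin: "finite V" by (simp add: V_def)
  have card: "card V = 6" using distinct_card[OF dist] by (simp add: V_def)
  have indep: "v \<notin> convex hull (V - {v})" if "v \<in> V" for v
    using ccw_convex_independent[OF ccw dist, of v] that by (simp add: V_def)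
  define P where "P = convex hull V"
  have P: "convex_ngon 6 P" "{v. v extreme_point_of P} = V"
    using convex_ngon_of_independent[OF fin indep] card by (simp_all add: P_def)
  have area: "area P = 3" using area_hexagon[OF ccw] by (simp add: P_def V_def pts orient_def)
  have ears: "area (convex hull (V - {v})) = 5 / 2" if "v \<in> V" for v
  proof -
    have "orient f a b = 1" "orient a b c = 1" "orient b c d = 1" "orient c d e = 1" "orient d e f = 1" "orient e f a = 1"
      by (simp_all add: pts orient_def)
    then have "area (convex hull (V - {a})) = 5 / 2" "area (convex hull (V - {b})) = 5 / 2"
      "area (convex hull (V - {c})) = 5 / 2" "area (convex hull (V - {d})) = 5 / 2"
      "area (convex hull (V - {e})) = 5 / 2" "area (convex hull (V - {f})) = 5 / 2"
      using area_hexagon_delete[OF ccw dist, folded V_def, folded P_def] area by simp_all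
    moreover have "v = a \<or> v = b \<or> v = c \<or> v = d \<or> v = e \<or> v = f" using that by (simp add: V_def)
    ultimately show ?thesis by metis
  qed
  obtain Y where Y: "Y \<subseteq> V" "card Y = 5" "max_ratio 5 P = area (convex hull Y) / area P"
    using max_ratio_vertices(1)[OF P(1), of 5] unfolding P(2) by auto
  have "card (V - Y) = 1" using Y fin card by (simp add: card_Diff_subset finite_subset)
  then obtain v where "V - Y = {v}" using card_1_singletonE by blast
  then have "v \<in> V" "Y = V - {v}" using Y(1) by auto
  then have "max_ratio 5 P = 5 / 6" using Y(3) ears area by simp
  then show thesis using that P by blast
qed

theorem theorem3p1: "minmax_ratio 6 5 = 5 / 6"
  unfolding minmax_ratio_def
proof (rule Least_equality)
  show "\<exists>P. convex_ngon 6 P \<and> 5 / 6 = max_ratio 5 P"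
    using affine_regular_hexagon_ratio by metis
next
  fix r assume "\<exists>P. convex_ngon 6 P \<and> r = max_ratio 5 P"
  then show "5 / 6 \<le> r" using max_ratio_hexagon_ge by blast
qed

end
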